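(* Let $G$ be an infinite, finitely generated group. Let $M$ be a complex Banach space with norm $\|\cdot\|_M$ that is also a left $\mathbb{C}G$-module such that the elements of $G$ act on $M$ as continuous $\mathbb{C}$-linear transformations. Suppose that $\mathbb{C}G\subset M\subset L^p(G)$ for some $p\in\mathbb{N}$, $p\ge 1$ (inclusions of $G$-modules). Then the $G$-module imbedding $\mathbb{C}G\to M$ induces an imbedding (injective homomorphism) of groups $H^1(G,\mathbb{C}G)\to H^1(G,M)$.
   Context: $\mathbb{C}G$ is the set of finite formal sums $\sum_{g\in G}a_g g$ with $a_g\in\mathbb{C}$. For $1\le p<\infty$, $L^p(G)$ is the set of all (not necessarily finite) formal sums $\sum_{g\in G}a_g g$, $a_g\in\mathbb{C}$, with $\sum_g|a_g|^p<\infty$. $G$ acts on both by left multiplication: $h\cdot\sum_g a_g g=\sum_g a_g\,hg$. A $G$-module is a $\mathbb{C}$-vector space $N$ with a homomorphism $G\to\mathrm{Aut}(N)$. For a $G$-module $N$, $H^1(G,N)=A_G/B_G$, where $A_G$ is the set of maps $f:G\to N$ with $a\cdot f(b)-f(ab)+f(a)=0$ for all $a,b\in G$, and $B_G$ is the set of maps of the form $f(b)=b\cdot\alpha-\alpha$ for some fixed $\alpha\in N$. The induced map sends the class of a cocycle $f:G\to\mathbb{C}G$ to the class of $f$ regarded as a map $G\to M$. *)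

theory Defs
  imports "HOL-Analysis.Analysis" "HOL-Algebra.Algebra" "HOL-Algebra.Algebraic_Closure_Type"
begin

section \<open>Modules over a group\<close>

definition finitely_generated :: "('g, 'z) monoid_scheme \<Rightarrow> bool" where
  "finitely_generated G \<longleftrightarrow> (\<exists>S. finite S \<and> S \<subseteq> carrier G \<and> generate G S = carrier G)"

abbreviation complex_field :: "complex ring" where
  "complex_field \<equiv> ring_of_type_algebra"

record ('m, 'g) gmodule = "(complex, 'm) module" +
  act :: "'g \<Rightarrow> 'm \<Rightarrow> 'm"

definition linear_maps ::
    "(complex, 'm, 'x) module_scheme \<Rightarrow> (complex, 'n, 'y) module_scheme \<Rightarrow> ('m \<Rightarrow> 'n) set" where
  "linear_maps N N' = {\<phi> \<in> carrier N \<rightarrow> carrier N'.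
     (\<forall>x\<in>carrier N. \<forall>y\<in>carrier N. \<phi> (x \<oplus>\<^bsub>N\<^esub> y) = \<phi> x \<oplus>\<^bsub>N'\<^esub> \<phi> y) \<and>
     (\<forall>c. \<forall>x\<in>carrier N. \<phi> (c \<odot>\<^bsub>N\<^esub> x) = c \<odot>\<^bsub>N'\<^esub> \<phi> x)}"

definition linear_Aut :: "(complex, 'm, 'x) module_scheme \<Rightarrow> ('m \<Rightarrow> 'm) monoid" where
  "linear_Aut N = BijGroup (carrier N) \<lparr>carrier := linear_maps N N \<inter> Bij (carrier N)\<rparr>"

locale G_module = G?: group G + N?: module complex_field N
  for G :: "('g, 'z) monoid_scheme" (structure) and N :: "('m, 'g) gmodule" (structure) +
  assumes act_hom: "act N \<in> hom G (linear_Aut N)"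

definition G_module_maps ::
    "('g, 'z) monoid_scheme \<Rightarrow> ('m, 'g) gmodule \<Rightarrow> ('n, 'g) gmodule \<Rightarrow> ('m \<Rightarrow> 'n) set" where
  "G_module_maps G N N' = {\<phi> \<in> linear_maps N N'.
     \<forall>g\<in>carrier G. \<forall>x\<in>carrier N. \<phi> (act N g x) = act N' g (\<phi> x)}"

definition G_inclusion ::
    "('g, 'z) monoid_scheme \<Rightarrow> ('m, 'g) gmodule \<Rightarrow> ('m, 'g) gmodule \<Rightarrow> bool" where
  "G_inclusion G N N' \<longleftrightarrow> carrier N \<subseteq> carrier N' \<and> (\<lambda>x. x) \<in> G_module_maps G N N'"


section \<open>First cohomology\<close>

definition cocycles :: "('g, 'z) monoid_scheme \<Rightarrow> ('m, 'g) gmodule \<Rightarrow> ('g \<Rightarrow> 'm) set" where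
  "cocycles G N = {f \<in> carrier G \<rightarrow>\<^sub>E carrier N.
     \<forall>a\<in>carrier G. \<forall>b\<in>carrier G.
       act N a (f b) \<ominus>\<^bsub>N\<^esub> f (a \<otimes>\<^bsub>G\<^esub> b) \<oplus>\<^bsub>N\<^esub> f a = \<zero>\<^bsub>N\<^esub>}"

definition coboundaries :: "('g, 'z) monoid_scheme \<Rightarrow> ('m, 'g) gmodule \<Rightarrow> ('g \<Rightarrow> 'm) set" where
  "coboundaries G N = {(\<lambda>b\<in>carrier G. act N b \<alpha> \<ominus>\<^bsub>N\<^esub> \<alpha>) | \<alpha>. \<alpha> \<in> carrier N}"

definition cocycle_group :: "('g, 'z) monoid_scheme \<Rightarrow> ('m, 'g) gmodule \<Rightarrow> ('g \<Rightarrow> 'm) monoid" where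
  "cocycle_group G N =
     \<lparr>carrier = cocycles G N,
      mult = (\<lambda>f f'. \<lambda>a\<in>carrier G. f a \<oplus>\<^bsub>N\<^esub> f' a),
      one = (\<lambda>a\<in>carrier G. \<zero>\<^bsub>N\<^esub>)\<rparr>"

definition H1 :: "('g, 'z) monoid_scheme \<Rightarrow> ('m, 'g) gmodule \<Rightarrow> ('g \<Rightarrow> 'm) set monoid" where
  "H1 G N = cocycle_group G N Mod coboundaries G N"

definition H1_class ::
    "('g, 'z) monoid_scheme \<Rightarrow> ('m, 'g) gmodule \<Rightarrow> ('g \<Rightarrow> 'm) \<Rightarrow> ('g \<Rightarrow> 'm) set" where
  "H1_class G N f = coboundaries G N #>\<^bsub>cocycle_group G N\<^esub> f"

text \<open>The value on a class is computed from its representatives; \<open>H1_map_class\<close> below shows that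
  it does not depend on their choice.\<close>

definition H1_map ::
    "('g, 'z) monoid_scheme \<Rightarrow> ('m, 'g) gmodule \<Rightarrow> ('n, 'g) gmodule \<Rightarrow> ('m \<Rightarrow> 'n) \<Rightarrow>
     ('g \<Rightarrow> 'm) set \<Rightarrow> ('g \<Rightarrow> 'n) set" where
  "H1_map G N N' \<phi> C = the_elem ((\<lambda>f. H1_class G N' (\<lambda>a\<in>carrier G. \<phi> (f a))) ` C)"


section \<open>Formal sums over a group\<close>

text \<open>The formal sum with coefficients \<open>a\<^sub>g\<close> is the function \<open>g \<mapsto> a\<^sub>g\<close>, extended by \<open>0\<close> outside
  \<open>carrier G\<close>. The coefficient of \<open>h \<cdot> a\<close> at \<open>x\<close> is \<open>a\<close> at \<open>h\<^sup>-\<^sup>1 x\<close>. The fields \<open>mult\<close> and \<open>one\<close>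
  play no role in modules.\<close>

definition formal_sums :: "('g, 'z) monoid_scheme \<Rightarrow> ('g \<Rightarrow> complex) set" where
  "formal_sums G = {a. \<forall>g. g \<notin> carrier G \<longrightarrow> a g = 0}"

definition left_mult ::
    "('g, 'z) monoid_scheme \<Rightarrow> 'g \<Rightarrow> ('g \<Rightarrow> complex) \<Rightarrow> ('g \<Rightarrow> complex)" where
  "left_mult G h a = (\<lambda>x. if x \<in> carrier G then a (inv\<^bsub>G\<^esub> h \<otimes>\<^bsub>G\<^esub> x) else 0)"

definition formal_sum_module ::
    "('g, 'z) monoid_scheme \<Rightarrow> ('g \<Rightarrow> complex) set \<Rightarrow> ('g \<Rightarrow> complex, 'g) gmodule" where
  "formal_sum_module G A =
     \<lparr>carrier = A, mult = undefined, one = undefined,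
      ring.zero = (\<lambda>g. 0), ring.add = (\<lambda>a b g. a g + b g), smult = (\<lambda>c a g. c * a g),
      act = (\<lambda>h. \<lambda>a\<in>A. left_mult G h a)\<rparr>"

definition group_algebra :: "('g, 'z) monoid_scheme \<Rightarrow> ('g \<Rightarrow> complex, 'g) gmodule" where
  "group_algebra G = formal_sum_module G {a \<in> formal_sums G. finite {g. a g \<noteq> 0}}"

definition Lp :: "('g, 'z) monoid_scheme \<Rightarrow> real \<Rightarrow> ('g \<Rightarrow> complex, 'g) gmodule" where
  "Lp G p = formal_sum_module G
     {a \<in> formal_sums G. (\<lambda>g. cmod (a g) powr p) summable_on carrier G}"


section \<open>Banach norms on the carrier of a module\<close>

text \<open>The value \<open>0\<close> outside the carrier only serves the library's requirement that distances be
  symmetric and nonnegative on the whole type.\<close>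

definition norm_dist ::
    "(complex, 'm, 'x) module_scheme \<Rightarrow> ('m \<Rightarrow> real) \<Rightarrow> 'm \<Rightarrow> 'm \<Rightarrow> real" where
  "norm_dist N nrm x y =
     (if x \<in> carrier N \<and> y \<in> carrier N then nrm (x \<ominus>\<^bsub>N\<^esub> y) else 0)"

abbreviation norm_topology ::
    "(complex, 'm, 'x) module_scheme \<Rightarrow> ('m \<Rightarrow> real) \<Rightarrow> 'm topology" where
  "norm_topology N nrm \<equiv> Metric_space.mtopology (carrier N) (norm_dist N nrm)"

locale complex_normed_module = module complex_field N
  for N :: "(complex, 'm, 'x) module_scheme" (structure) +
  fixes nrm :: "'m \<Rightarrow> real"
  assumes norm_nonneg: "x \<in> carrier N \<Longrightarrow> 0 \<le> nrm x"
    and norm_eq_0: "x \<in> carrier N \<Longrightarrow> nrm x = 0 \<longleftrightarrow> x = \<zero>"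
    and norm_smult: "x \<in> carrier N \<Longrightarrow> nrm (c \<odot> x) = cmod c * nrm x"
    and norm_triangle: "\<lbrakk>x \<in> carrier N; y \<in> carrier N\<rbrakk> \<Longrightarrow> nrm (x \<oplus> y) \<le> nrm x + nrm y"

locale complex_banach_module = complex_normed_module +
  assumes complete: "Metric_space.mcomplete (carrier N) (norm_dist N nrm)"


section \<open>Basic facts\<close>

lemma complex_field_simps [simp]:
  "carrier complex_field = UNIV" "x \<otimes>\<^bsub>complex_field\<^esub> y = x * y"
  "x \<oplus>\<^bsub>complex_field\<^esub> y = x + y" "\<one>\<^bsub>complex_field\<^esub> = 1" "\<zero>\<^bsub>complex_field\<^esub> = 0"
  by (simp_all add: ring_of_type_algebra_def)

lemma complex_field_minus_one: "\<ominus>\<^bsub>complex_field\<^esub> \<one>\<^bsub>complex_field\<^esub> = -1"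
proof -
  interpret cring complex_field by (rule cring_from_type_algebra)
  have "(-1) \<oplus>\<^bsub>complex_field\<^esub> \<one>\<^bsub>complex_field\<^esub> = \<zero>\<^bsub>complex_field\<^esub>" by simp
  then show ?thesis by (intro minus_equality) auto
qed

lemma (in abelian_group) minus_eq_zero_iff:
  "\<lbrakk>x \<in> carrier G; y \<in> carrier G\<rbrakk> \<Longrightarrow> x \<ominus> y = \<zero> \<longleftrightarrow> x = y"
  by (metis a_minus_def a_inv_closed minus_equality minus_minus r_neg)

lemma (in complex_normed_module) Metric_space_norm: "Metric_space (carrier N) (norm_dist N nrm)"
proof
  fix x y z
  have neg: "nrm (\<ominus> u) = nrm u" if "u \<in> carrier N" for u
    using norm_smult[OF that, of "-1"] smult_l_minus[of "\<one>\<^bsub>complex_field\<^esub>" u] that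
      complex_field_minus_one smult_one[OF that] by simp
  show "0 \<le> norm_dist N nrm x y"
    by (simp add: norm_dist_def norm_nonneg)
  show "norm_dist N nrm x y = norm_dist N nrm y x"
  proof (cases "x \<in> carrier N \<and> y \<in> carrier N")
    case True
    then have "y \<ominus> x = \<ominus> (x \<ominus> y)"
      by (simp add: a_minus_def minus_add a_comm)
    with True neg[of "x \<ominus> y"] show ?thesis by (simp add: norm_dist_def)
  qed (auto simp: norm_dist_def)
  assume xy: "x \<in> carrier N" "y \<in> carrier N"
  then show "norm_dist N nrm x y = 0 \<longleftrightarrow> x = y"
    by (simp add: norm_dist_def norm_eq_0 M.minus_eq_zero_iff)
  assume z: "z \<in> carrier N"
  have "x \<ominus> z = (x \<ominus> y) \<oplus> (y \<ominus> z)"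
    using xy z by (simp add: a_minus_def a_assoc r_neg1)
  then show "norm_dist N nrm x z \<le> norm_dist N nrm x y + norm_dist N nrm y z"
    using xy z norm_triangle[of "x \<ominus> y" "y \<ominus> z"] by (simp add: norm_dist_def)
qed

context G_module
begin

lemma act_Bij: "g \<in> carrier G \<Longrightarrow> act N g \<in> linear_maps N N \<inter> Bij (carrier N)"
  using act_hom by (auto simp: hom_def linear_Aut_def)

lemma act_closed [simp]: "\<lbrakk>g \<in> carrier G; x \<in> carrier N\<rbrakk> \<Longrightarrow> act N g x \<in> carrier N"
  using act_Bij[of g] by (auto simp: linear_maps_def)

lemma act_add: "\<lbrakk>g \<in> carrier G; x \<in> carrier N; y \<in> carrier N\<rbrakk>
    \<Longrightarrow> act N g (x \<oplus>\<^bsub>N\<^esub> y) = act N g x \<oplus>\<^bsub>N\<^esub> act N g y"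
  using act_Bij[of g] by (auto simp: linear_maps_def)

lemma act_mult: "\<lbrakk>g \<in> carrier G; h \<in> carrier G; x \<in> carrier N\<rbrakk>
    \<Longrightarrow> act N (g \<otimes> h) x = act N g (act N h x)"
proof -
  assume *: "g \<in> carrier G" "h \<in> carrier G" "x \<in> carrier N"
  have "act N (g \<otimes> h) = act N g \<otimes>\<^bsub>linear_Aut N\<^esub> act N h"
    using act_hom * by (simp add: hom_def)
  then show ?thesis
    using act_Bij[of g] act_Bij[of h] * by (simp add: linear_Aut_def BijGroup_def compose_def)
qed

lemma act_zero [simp]: "g \<in> carrier G \<Longrightarrow> act N g \<zero>\<^bsub>N\<^esub> = \<zero>\<^bsub>N\<^esub>"
  using act_add[of g "\<zero>\<^bsub>N\<^esub>" "\<zero>\<^bsub>N\<^esub>"] by (simp add: N.M.add.l_cancel_one')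

lemma act_uminus: "\<lbrakk>g \<in> carrier G; x \<in> carrier N\<rbrakk> \<Longrightarrow> act N g (\<ominus>\<^bsub>N\<^esub> x) = \<ominus>\<^bsub>N\<^esub> act N g x"
  using act_add[of g "\<ominus>\<^bsub>N\<^esub> x" x]
  by (intro N.M.minus_equality[symmetric]) (simp_all add: N.M.l_neg)

lemma cocycle_closed [simp]: "\<lbrakk>f \<in> cocycles G N; a \<in> carrier G\<rbrakk> \<Longrightarrow> f a \<in> carrier N"
  by (auto simp: cocycles_def)

lemma cocycle_iff: "f \<in> cocycles G N \<longleftrightarrow> f \<in> carrier G \<rightarrow>\<^sub>E carrier N \<and>
    (\<forall>a\<in>carrier G. \<forall>b\<in>carrier G. f (a \<otimes> b) = act N a (f b) \<oplus>\<^bsub>N\<^esub> f a)"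
proof -
  have eq: "x \<ominus>\<^bsub>N\<^esub> y \<oplus>\<^bsub>N\<^esub> z = \<zero>\<^bsub>N\<^esub> \<longleftrightarrow> y = x \<oplus>\<^bsub>N\<^esub> z"
    if "x \<in> carrier N" "y \<in> carrier N" "z \<in> carrier N" for x y z
  proof -
    have "x \<ominus>\<^bsub>N\<^esub> y \<oplus>\<^bsub>N\<^esub> z = (x \<oplus>\<^bsub>N\<^esub> z) \<ominus>\<^bsub>N\<^esub> y"
      using that by (simp add: a_minus_def N.M.a_assoc N.M.a_comm N.M.a_lcomm)
    then show ?thesis using that by (auto simp: N.M.minus_eq_zero_iff)
  qed
  show ?thesis
  proof (cases "f \<in> carrier G \<rightarrow>\<^sub>E carrier N")
    case True
    then have "f a \<in> carrier N" if "a \<in> carrier G" for a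
      using that by (auto simp: N.M.minus_eq_zero_iff)
    with True show ?thesis by (simp add: cocycles_def eq)
  qed (simp add: cocycles_def)
qed

lemma cocycle_eqI:
  "\<lbrakk>f \<in> cocycles G N; f' \<in> extensional (carrier G); \<And>a. a \<in> carrier G \<Longrightarrow> f a = f' a\<rbrakk> \<Longrightarrow> f = f'"
  by (rule extensionalityI[of _ "carrier G"]) (auto simp: cocycle_iff PiE_def)

lemma add_swap: "\<lbrakk>x \<in> carrier N; y \<in> carrier N; z \<in> carrier N; w \<in> carrier N\<rbrakk>
    \<Longrightarrow> (x \<oplus>\<^bsub>N\<^esub> y) \<oplus>\<^bsub>N\<^esub> (z \<oplus>\<^bsub>N\<^esub> w) = (x \<oplus>\<^bsub>N\<^esub> z) \<oplus>\<^bsub>N\<^esub> (y \<oplus>\<^bsub>N\<^esub> w)"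
  by (simp add: N.M.a_assoc N.M.a_lcomm)

lemma cocycle_mult: "\<lbrakk>f \<in> cocycles G N; a \<in> carrier G; b \<in> carrier G\<rbrakk>
    \<Longrightarrow> f (a \<otimes> b) = act N a (f b) \<oplus>\<^bsub>N\<^esub> f a"
  by (simp add: cocycle_iff)

lemma cocycleI:
  assumes "\<And>a. a \<in> carrier G \<Longrightarrow> f a \<in> carrier N"
    and "\<And>a b. \<lbrakk>a \<in> carrier G; b \<in> carrier G\<rbrakk> \<Longrightarrow> f (a \<otimes> b) = act N a (f b) \<oplus>\<^bsub>N\<^esub> f a"
  shows "(\<lambda>a\<in>carrier G. f a) \<in> cocycles G N"
  using assms by (simp add: cocycle_iff)

lemma comm_group_cocycle_group: "comm_group (cocycle_group G N)"
proof (rule comm_groupI, simp_all only: cocycle_group_def partial_object.simps monoid.simps)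
  fix f assume f: "f \<in> cocycles G N"
  show "(\<lambda>a\<in>carrier G. (\<lambda>a\<in>carrier G. \<zero>\<^bsub>N\<^esub>) a \<oplus>\<^bsub>N\<^esub> f a) = f"
    using f by (intro cocycle_eqI[OF f, symmetric]) auto
  have "(\<lambda>a\<in>carrier G. \<ominus>\<^bsub>N\<^esub> f a) \<in> cocycles G N"
    by (rule cocycleI) (simp_all add: f cocycle_mult act_uminus N.M.minus_add)
  moreover have "(\<lambda>a\<in>carrier G. (\<lambda>a\<in>carrier G. \<ominus>\<^bsub>N\<^esub> f a) a \<oplus>\<^bsub>N\<^esub> f a) = (\<lambda>a\<in>carrier G. \<zero>\<^bsub>N\<^esub>)"
    by (rule restrict_ext) (simp add: f N.M.l_neg)
  ultimately show "\<exists>f'\<in>cocycles G N. (\<lambda>a\<in>carrier G. f' a \<oplus>\<^bsub>N\<^esub> f a) = (\<lambda>a\<in>carrier G. \<zero>\<^bsub>N\<^esub>)"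
    by blast
  fix f' assume f': "f' \<in> cocycles G N"
  show "(\<lambda>a\<in>carrier G. f a \<oplus>\<^bsub>N\<^esub> f' a) \<in> cocycles G N"
    by (rule cocycleI) (simp_all add: f f' cocycle_mult act_add add_swap)
  show "(\<lambda>a\<in>carrier G. f a \<oplus>\<^bsub>N\<^esub> f' a) = (\<lambda>a\<in>carrier G. f' a \<oplus>\<^bsub>N\<^esub> f a)"
    by (rule restrict_ext) (simp add: f f' N.M.a_comm)
  fix h assume h: "h \<in> cocycles G N"
  show "(\<lambda>a\<in>carrier G. (\<lambda>a\<in>carrier G. f a \<oplus>\<^bsub>N\<^esub> f' a) a \<oplus>\<^bsub>N\<^esub> h a) =
      (\<lambda>a\<in>carrier G. f a \<oplus>\<^bsub>N\<^esub> (\<lambda>a\<in>carrier G. f' a \<oplus>\<^bsub>N\<^esub> h a) a)"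
    by (rule restrict_ext) (simp add: f f' h N.M.a_assoc)
next
  show "(\<lambda>a\<in>carrier G. \<zero>\<^bsub>N\<^esub>) \<in> cocycles G N"
    by (rule cocycleI) simp_all
qed

lemma coboundaries_normal: "coboundaries G N \<lhd> cocycle_group G N"
proof -
  interpret Z: comm_group "cocycle_group G N" by (rule comm_group_cocycle_group)
  let ?d = "\<lambda>\<alpha>. \<lambda>b\<in>carrier G. act N b \<alpha> \<ominus>\<^bsub>N\<^esub> \<alpha>"
  have B: "coboundaries G N = ?d ` carrier N"
    by (auto simp: coboundaries_def)
  have closed: "?d \<alpha> \<in> carrier (cocycle_group G N)" if \<alpha>: "\<alpha> \<in> carrier N" for \<alpha>
  proof -
    have "act N (a \<otimes> b) \<alpha> \<ominus>\<^bsub>N\<^esub> \<alpha> = act N a (act N b \<alpha> \<ominus>\<^bsub>N\<^esub> \<alpha>) \<oplus>\<^bsub>N\<^esub> (act N a \<alpha> \<ominus>\<^bsub>N\<^esub> \<alpha>)"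
      if "a \<in> carrier G" "b \<in> carrier G" for a b
      using that \<alpha> by (simp add: a_minus_def act_mult act_add act_uminus N.M.a_assoc N.M.r_neg1)
    then have "?d \<alpha> \<in> cocycles G N"
      using \<alpha> by (intro cocycleI) simp_all
    then show ?thesis by (simp add: cocycle_group_def)
  qed
  have add: "?d \<alpha> \<otimes>\<^bsub>cocycle_group G N\<^esub> ?d \<beta> = ?d (\<alpha> \<oplus>\<^bsub>N\<^esub> \<beta>)"
    if "\<alpha> \<in> carrier N" "\<beta> \<in> carrier N" for \<alpha> \<beta>
    unfolding cocycle_group_def monoid.simps
    by (rule restrict_ext)
      (use that in \<open>simp add: a_minus_def act_add N.M.minus_add add_swap\<close>)
  have one: "?d \<zero>\<^bsub>N\<^esub> = \<one>\<^bsub>cocycle_group G N\<^esub>"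
    by (auto simp: cocycle_group_def fun_eq_iff a_minus_def)
  have "subgroup (coboundaries G N) (cocycle_group G N)"
  proof (rule Z.subgroupI)
    fix f assume "f \<in> coboundaries G N"
    then obtain \<alpha> where \<alpha>: "\<alpha> \<in> carrier N" "f = ?d \<alpha>" by (auto simp: B)
    have "inv\<^bsub>cocycle_group G N\<^esub> f = ?d (\<ominus>\<^bsub>N\<^esub> \<alpha>)"
      using \<alpha> closed add[of "\<ominus>\<^bsub>N\<^esub> \<alpha>" \<alpha>] one by (intro Z.inv_equality) (auto simp: N.M.l_neg)
    with \<alpha> show "inv\<^bsub>cocycle_group G N\<^esub> f \<in> coboundaries G N" by (auto simp: B)
  next
    fix f f' assume "f \<in> coboundaries G N" "f' \<in> coboundaries G N"
    then show "f \<otimes>\<^bsub>cocycle_group G N\<^esub> f' \<in> coboundaries G N" using add by (auto simp: B)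
  qed (use closed in \<open>auto simp: B\<close>)
  then show ?thesis by (rule Z.subgroup_imp_normal)
qed

lemma comm_group_H1: "comm_group (H1 G N)"
  unfolding H1_def
  using comm_group.abelian_FactGroup[OF comm_group_cocycle_group]
    normal_imp_subgroup[OF coboundaries_normal] by blast

lemma carrier_H1: "carrier (H1 G N) = H1_class G N ` cocycles G N"
  by (auto simp: H1_def FactGroup_def RCOSETS_def H1_class_def cocycle_group_def)

end

lemma H1_map_class:
  assumes "G_module G N" "G_module G N'" and \<phi>: "\<phi> \<in> G_module_maps G N N'" and f: "f \<in> cocycles G N"
  shows "H1_map G N N' \<phi> (H1_class G N f) = H1_class G N' (\<lambda>a\<in>carrier G. \<phi> (f a))"
proof -
  interpret N: G_module G N by fact
  interpret N': G_module G N' by fact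
  interpret Z: comm_group "cocycle_group G N" by (rule N.comm_group_cocycle_group)
  interpret Z': comm_group "cocycle_group G N'" by (rule N'.comm_group_cocycle_group)
  let ?\<phi> = "\<lambda>f. \<lambda>a\<in>carrier G. \<phi> (f a)"
  have closed: "\<phi> x \<in> carrier N'" if "x \<in> carrier N" for x
    using \<phi> that by (auto simp: G_module_maps_def linear_maps_def)
  have add: "\<phi> (x \<oplus>\<^bsub>N\<^esub> y) = \<phi> x \<oplus>\<^bsub>N'\<^esub> \<phi> y" if "x \<in> carrier N" "y \<in> carrier N" for x y
    using \<phi> that by (auto simp: G_module_maps_def linear_maps_def)
  have act: "\<phi> (act N g x) = act N' g (\<phi> x)" if "g \<in> carrier G" "x \<in> carrier N" for g x
    using \<phi> that by (auto simp: G_module_maps_def)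
  have minus: "\<phi> (x \<ominus>\<^bsub>N\<^esub> y) = \<phi> x \<ominus>\<^bsub>N'\<^esub> \<phi> y" if "x \<in> carrier N" "y \<in> carrier N" for x y
  proof -
    have "\<phi> x = \<phi> (x \<ominus>\<^bsub>N\<^esub> y) \<oplus>\<^bsub>N'\<^esub> \<phi> y"
      using that by (simp flip: add add: a_minus_def N.N.M.a_assoc N.N.M.l_neg)
    then show ?thesis
      using that closed by (simp add: a_minus_def N'.N.M.a_assoc N'.N.M.r_neg)
  qed
  have coc: "?\<phi> h \<in> cocycles G N'" if "h \<in> cocycles G N" for h
    by (rule N'.cocycleI) (simp_all add: that N.cocycle_mult closed add act)
  have same: "H1_class G N' (?\<phi> h) = H1_class G N' (?\<phi> f)" if h: "h \<in> H1_class G N f" for h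
  proof -
    from h obtain \<alpha> where \<alpha>: "\<alpha> \<in> carrier N"
      and h_eq: "h = (\<lambda>b\<in>carrier G. act N b \<alpha> \<ominus>\<^bsub>N\<^esub> \<alpha>) \<otimes>\<^bsub>cocycle_group G N\<^esub> f"
      by (auto simp: H1_class_def r_coset_def coboundaries_def)
    have "?\<phi> h = (\<lambda>b\<in>carrier G. act N' b (\<phi> \<alpha>) \<ominus>\<^bsub>N'\<^esub> \<phi> \<alpha>) \<otimes>\<^bsub>cocycle_group G N'\<^esub> ?\<phi> f"
      unfolding h_eq cocycle_group_def monoid.simps
      by (rule restrict_ext) (use \<alpha> f in \<open>simp add: add act minus\<close>)
    then have "?\<phi> h \<in> H1_class G N' (?\<phi> f)"
      using \<alpha> closed by (auto simp: H1_class_def r_coset_def coboundaries_def)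
    then show ?thesis
      using Z'.repr_independence[of "?\<phi> h" "coboundaries G N'" "?\<phi> f"] coc[OF f]
        normal_imp_subgroup[OF N'.coboundaries_normal]
      by (simp add: H1_class_def cocycle_group_def)
  qed
  have "f \<in> H1_class G N f"
    using Z.rcos_self[of f] f normal_imp_subgroup[OF N.coboundaries_normal]
    by (simp add: H1_class_def cocycle_group_def)
  then have "H1_class G N f \<noteq> {}" by blast
  then show ?thesis
    unfolding H1_map_def by (rule the_elem_image_unique) (rule same)
qed

lemma (in group) G_module_formal_sum_module:
  assumes A: "A \<subseteq> formal_sums G" and zero: "(\<lambda>g. 0) \<in> A"
    and add: "\<And>a b. \<lbrakk>a \<in> A; b \<in> A\<rbrakk> \<Longrightarrow> (\<lambda>g. a g + b g) \<in> A"
    and smult: "\<And>c a. a \<in> A \<Longrightarrow> (\<lambda>g. c * a g) \<in> A"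
    and left: "\<And>h a. \<lbrakk>h \<in> carrier G; a \<in> A\<rbrakk> \<Longrightarrow> left_mult G h a \<in> A"
  shows "G_module G (formal_sum_module G A)"
proof -
  have mod: "module complex_field (formal_sum_module G A)"
  proof (rule moduleI)
    show "abelian_group (formal_sum_module G A)"
    proof (rule abelian_groupI)
      fix a assume "a \<in> carrier (formal_sum_module G A)"
      then show "\<exists>b\<in>carrier (formal_sum_module G A).
          b \<oplus>\<^bsub>formal_sum_module G A\<^esub> a = \<zero>\<^bsub>formal_sum_module G A\<^esub>"
        using smult[of a "-1"] by (intro bexI[of _ "\<lambda>g. -1 * a g"]) (auto simp: formal_sum_module_def)
    qed (auto simp: formal_sum_module_def zero add algebra_simps)
  qed (auto simp: formal_sum_module_def smult algebra_simps cring_from_type_algebra)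
  have comp: "left_mult G g (left_mult G h a) = left_mult G (g \<otimes> h) a"
    if "g \<in> carrier G" "h \<in> carrier G" for g h a
    using that by (auto simp: left_mult_def fun_eq_iff inv_mult_group m_assoc)
  have one: "left_mult G \<one> a = a" if "a \<in> A" for a
    using that A by (auto simp: left_mult_def fun_eq_iff formal_sums_def)
  have lin: "act (formal_sum_module G A) g \<in> linear_maps (formal_sum_module G A) (formal_sum_module G A)"
    if "g \<in> carrier G" for g
    using that by (auto simp: linear_maps_def formal_sum_module_def left add smult)
      (auto simp: left_mult_def fun_eq_iff)
  have bij: "act (formal_sum_module G A) g \<in> Bij A" if g: "g \<in> carrier G" for g
  proof -
    have "bij_betw (left_mult G g) A A"
      by (rule bij_betw_byWitness[of _ "left_mult G (inv g)"]) (auto simp: g comp one left)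
    then have "bij_betw (\<lambda>a\<in>A. left_mult G g a) A A"
      by (simp cong: bij_betw_cong)
    then show ?thesis by (simp add: Bij_def formal_sum_module_def)
  qed
  have "act (formal_sum_module G A) \<in> hom G (linear_Aut (formal_sum_module G A))"
    using lin bij left comp
    by (auto simp: hom_def linear_Aut_def BijGroup_def formal_sum_module_def compose_def fun_eq_iff)
  with mod show ?thesis
    by (intro G_module.intro G_module_axioms.intro is_group)
qed

lemma (in group) G_module_group_algebra: "G_module G (group_algebra G)"
  unfolding group_algebra_def
proof (rule G_module_formal_sum_module)
  fix a b h assume a: "a \<in> {a \<in> formal_sums G. finite {g. a g \<noteq> 0}}"
  {
    assume b: "b \<in> {a \<in> formal_sums G. finite {g. a g \<noteq> 0}}"
    have "finite {g. a g + b g \<noteq> 0}"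
      by (rule finite_subset[of _ "{g. a g \<noteq> 0} \<union> {g. b g \<noteq> 0}"]) (use a b in auto)
    with a b show "(\<lambda>g. a g + b g) \<in> {a \<in> formal_sums G. finite {g. a g \<noteq> 0}}"
      by (simp add: formal_sums_def)
  }
  have "finite {g. c * a g \<noteq> 0}" for c
    by (rule finite_subset[of _ "{g. a g \<noteq> 0}"]) (use a in auto)
  with a show "(\<lambda>g. c * a g) \<in> {a \<in> formal_sums G. finite {g. a g \<noteq> 0}}" for c
    by (simp add: formal_sums_def)
  assume h: "h \<in> carrier G"
  have "{x. left_mult G h a x \<noteq> 0} \<subseteq> (\<lambda>y. h \<otimes> y) ` {g. a g \<noteq> 0}"
  proof
    fix x assume "x \<in> {x. left_mult G h a x \<noteq> 0}"
    then have x: "x \<in> carrier G" "a (inv h \<otimes> x) \<noteq> 0"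
      by (simp_all add: left_mult_def split: if_splits)
    moreover have "x = h \<otimes> (inv h \<otimes> x)"
      using x h by (simp flip: m_assoc)
    ultimately show "x \<in> (\<lambda>y. h \<otimes> y) ` {g. a g \<noteq> 0}" by blast
  qed
  then have "finite {x. left_mult G h a x \<noteq> 0}"
    using a by (blast intro: finite_subset)
  then show "left_mult G h a \<in> {a \<in> formal_sums G. finite {g. a g \<noteq> 0}}"
    by (simp add: formal_sums_def left_mult_def)
qed (auto simp: formal_sums_def)

lemma (in group) G_module_Lp:
  assumes p: "p \<ge> 1"
  shows "G_module G (Lp G p)"
  unfolding Lp_def
proof (rule G_module_formal_sum_module)
  fix a b h assume a: "a \<in> {a \<in> formal_sums G. (\<lambda>g. cmod (a g) powr p) summable_on carrier G}"
  {
    assume b: "b \<in> {a \<in> formal_sums G. (\<lambda>g. cmod (a g) powr p) summable_on carrier G}"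
    have "cmod (x + y) powr p \<le> 2 powr p * (cmod x powr p + cmod y powr p)" for x y
    proof -
      have "cmod (x + y) powr p \<le> (2 * max (cmod x) (cmod y)) powr p"
        using p norm_triangle_ineq[of x y] by (intro powr_mono2) auto
      also have "\<dots> = 2 powr p * max (cmod x) (cmod y) powr p"
        by (simp add: powr_mult)
      also have "\<dots> \<le> 2 powr p * (cmod x powr p + cmod y powr p)"
        by (intro mult_left_mono) (auto simp: max_def)
      finally show ?thesis .
    qed
    note le = this
    have "(\<lambda>g. cmod (a g) powr p + cmod (b g) powr p) summable_on carrier G"
      using a b by (simp add: summable_on_add)
    then have "(\<lambda>g. 2 powr p * (cmod (a g) powr p + cmod (b g) powr p)) summable_on carrier G"
      by (rule summable_on_cmult_right)
    then have "(\<lambda>g. cmod (a g + b g) powr p) summable_on carrier G"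
      by (rule summable_on_comparison_test) (simp_all add: le)
    with a b show "(\<lambda>g. a g + b g) \<in> {a \<in> formal_sums G. (\<lambda>g. cmod (a g) powr p) summable_on carrier G}"
      by (auto simp: formal_sums_def)
  }
  show "(\<lambda>g. c * a g) \<in> {a \<in> formal_sums G. (\<lambda>g. cmod (a g) powr p) summable_on carrier G}" for c
    using a summable_on_cmult_right[of "\<lambda>g. cmod (a g) powr p" "carrier G" "cmod c powr p"]
    by (simp add: formal_sums_def norm_mult powr_mult)
  assume h: "h \<in> carrier G"
  have "bij_betw (\<lambda>x. inv h \<otimes> x) (carrier G) (carrier G)"
    by (rule bij_betw_byWitness[of _ "\<lambda>x. h \<otimes> x"]) (auto simp: h simp flip: m_assoc)
  then have "(\<lambda>x. cmod (a (inv h \<otimes> x)) powr p) summable_on carrier G"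
    using a summable_on_reindex_bij_betw[of "\<lambda>x. inv h \<otimes> x" "carrier G" "carrier G" "\<lambda>g. cmod (a g) powr p"]
    by simp
  then have "(\<lambda>x. cmod (left_mult G h a x) powr p) summable_on carrier G"
    by (subst summable_on_cong[of _ _ "\<lambda>x. cmod (a (inv h \<otimes> x)) powr p"]) (simp_all add: left_mult_def)
  then show "left_mult G h a \<in> {a \<in> formal_sums G. (\<lambda>g. cmod (a g) powr p) summable_on carrier G}"
    by (simp add: formal_sums_def left_mult_def)
qed (auto simp: formal_sums_def)

end

theory Submission
  imports Defs
begin

text \<open>The map on \<open>H\<^sup>1\<close> is a homomorphism by functoriality, so its kernel decides injectivity. A class in
  the kernel is represented by a cocycle \<open>f\<close> with finitely supported values such that
  \<open>f g = g \<cdot> \<alpha> - \<alpha>\<close> for some \<open>\<alpha> \<in> M\<close>, and it suffices to show that \<open>\<alpha>\<close> itself has finite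
  support, for then \<open>f\<close> is already a coboundary over the group algebra.

  Let \<open>S\<close> be a finite generating set. All functions \<open>g \<cdot> \<alpha> - \<alpha>\<close> being finitely supported, the
  set \<open>K\<close> of those \<open>x\<close> for which \<open>\<alpha> (s x) \<noteq> \<alpha> x\<close> or \<open>\<alpha> (s\<^sup>-\<^sup>1 x) \<noteq> \<alpha> x\<close> for some \<open>s \<in> S\<close> is finite.
  Multiplying successively by generators and their inverses, one reaches every \<open>x\<close> from the identity, and
  a step can change the value of \<open>\<alpha>\<close> only when it ends in \<open>K\<close>. Hence \<open>\<alpha>\<close> takes only
  finitely many values (\<open>finitely_many_values\<close>). On the other hand \<open>\<alpha> \<in> L\<^sup>p\<close> takes each nonzero
  value only finitely often (\<open>finite_level_set\<close>). So \<open>\<alpha>\<close> has finite support.\<close>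

section \<open>Almost invariant functions on a finitely generated group\<close>

text \<open>The hypothesis says that every translate of \<open>a\<close> differs from \<open>a\<close> at finitely many points only,
  as in the theory of ends of groups.\<close>

lemma (in group) finitely_many_values:
  fixes a :: "'a \<Rightarrow> 'c"
  assumes fg: "finitely_generated G"
    and fin: "\<And>h. h \<in> carrier G \<Longrightarrow> finite {x \<in> carrier G. a (inv h \<otimes> x) \<noteq> a x}"
  shows "finite (a ` carrier G)"
proof -
  from fg obtain S where S: "finite S" "S \<subseteq> carrier G" "generate G S = carrier G"
    by (auto simp: finitely_generated_def)
  \<comment> \<open>Closing the generating set under inverses makes every group element a product of elements of \<open>T\<close>.\<close>
  define T where "T = S \<union> m_inv G ` S"
  have T: "finite T" "T \<subseteq> carrier G"
    using S by (auto simp: T_def)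
  define K where "K = (\<Union>t\<in>T. {x \<in> carrier G. a (inv t \<otimes> x) \<noteq> a x})"
  define V where "V = insert (a \<one>) (a ` K)"
  have "finite V"
    using T fin by (auto simp: V_def K_def)
  have step: "a (t \<otimes> x) \<in> V" if t: "t \<in> T" and x: "x \<in> carrier G" and ax: "a x \<in> V" for t x
  proof (cases "t \<otimes> x \<in> K")
    case True
    then show ?thesis by (simp add: V_def)
  next
    case False
    have "t \<in> carrier G" using t T by blast
    moreover from this have "a (inv t \<otimes> (t \<otimes> x)) = a (t \<otimes> x)"
      using False t x by (auto simp: K_def)
    ultimately show ?thesis
      using ax x by (simp flip: m_assoc)
  qed
  \<comment> \<open>Quantifying over the starting point \<open>x\<close> lets products be treated one factor at a time.\<close>
  have "\<forall>x\<in>carrier G. a x \<in> V \<longrightarrow> a (g \<otimes> x) \<in> V" if "g \<in> generate G S" for g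
    using that
  proof induction
    case one
    then show ?case by simp
  next
    case (incl h)
    then show ?case using step by (simp add: T_def)
  next
    case (inv h)
    then show ?case using step by (simp add: T_def)
  next
    case (eng h1 h2)
    have "h1 \<in> carrier G" "h2 \<in> carrier G"
      using eng.hyps S by auto
    then show ?case
      using eng.IH by (simp add: m_assoc)
  qed
  then have "a (g \<otimes> \<one>) \<in> V" if "g \<in> carrier G" for g
    using that S(3) by (metis V_def insertI1 one_closed)
  then have "a ` carrier G \<subseteq> V" by auto
  with \<open>finite V\<close> show ?thesis by (rule finite_subset[rotated])
qed

lemma finite_level_set:
  fixes a :: "'a \<Rightarrow> complex"
  assumes sum: "(\<lambda>x. cmod (a x) powr p) summable_on A" and "c \<noteq> 0"
  shows "finite {x \<in> A. a x = c}"
proof (rule ccontr)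
  assume inf: "infinite {x \<in> A. a x = c}"
  have "(\<lambda>x. cmod (a x) powr p) summable_on {x \<in> A. a x = c}"
    by (rule summable_on_subset_banach[OF sum]) auto
  then have "(\<lambda>x. cmod c powr p) summable_on {x \<in> A. a x = c}"
    by (subst summable_on_cong[of _ _ "\<lambda>x. cmod (a x) powr p"]) auto
  with infsum_diverge_constant[OF inf, of "cmod c powr p"] \<open>c \<noteq> 0\<close> show False
    by simp
qed

lemma (in group) almost_invariant_finite_support:
  assumes fg: "finitely_generated G"
    and fin: "\<And>h. h \<in> carrier G \<Longrightarrow> finite {x \<in> carrier G. a (inv h \<otimes> x) \<noteq> a x}"
    and sum: "(\<lambda>x. cmod (a x) powr p) summable_on carrier G"
  shows "finite {x \<in> carrier G. a x \<noteq> 0}"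
proof -
  have "{x \<in> carrier G. a x \<noteq> 0} = (\<Union>c\<in>a ` carrier G - {0}. {x \<in> carrier G. a x = c})"
    by auto
  then show ?thesis
    using finitely_many_values[OF fg fin] finite_level_set[OF sum] by simp
qed

section \<open>Functoriality of first cohomology\<close>

lemma cocycles_map:
  assumes "G_module G N" "G_module G N'" and \<phi>: "\<phi> \<in> G_module_maps G N N'" and f: "f \<in> cocycles G N"
  shows "(\<lambda>a\<in>carrier G. \<phi> (f a)) \<in> cocycles G N'"
proof -
  interpret N: G_module G N by fact
  interpret N': G_module G N' by fact
  show ?thesis
    by (rule N'.cocycleI)
      (use \<phi> f in \<open>auto simp: N.cocycle_mult G_module_maps_def linear_maps_def\<close>)
qed

lemma H1_map_hom:
  assumes N: "G_module G N" and N': "G_module G N'" and \<phi>: "\<phi> \<in> G_module_maps G N N'"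
  shows "H1_map G N N' \<phi> \<in> hom (H1 G N) (H1 G N')"
proof -
  interpret N: G_module G N by fact
  interpret N': G_module G N' by fact
  interpret Z: normal "coboundaries G N" "cocycle_group G N" by (rule N.coboundaries_normal)
  interpret Z': normal "coboundaries G N'" "cocycle_group G N'" by (rule N'.coboundaries_normal)
  let ?\<phi> = "\<lambda>f. \<lambda>a\<in>carrier G. \<phi> (f a)"
  have coc: "?\<phi> f \<in> carrier (cocycle_group G N')" if "f \<in> carrier (cocycle_group G N)" for f
    using cocycles_map[OF N N' \<phi>] that by (simp add: cocycle_group_def)
  have mult: "?\<phi> (f \<otimes>\<^bsub>cocycle_group G N\<^esub> f') = ?\<phi> f \<otimes>\<^bsub>cocycle_group G N'\<^esub> ?\<phi> f'"
    if "f \<in> carrier (cocycle_group G N)" "f' \<in> carrier (cocycle_group G N)" for f f'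
    unfolding cocycle_group_def monoid.simps
    by (rule restrict_ext)
      (use \<phi> that in \<open>auto simp: cocycle_group_def G_module_maps_def linear_maps_def\<close>)
  have cl: "H1_map G N N' \<phi> (H1_class G N f) = H1_class G N' (?\<phi> f)"
    if "f \<in> carrier (cocycle_group G N)" for f
    using H1_map_class[OF N N' \<phi>] that by (simp add: cocycle_group_def)
  have classes: "carrier (H1 G N) = H1_class G N ` carrier (cocycle_group G N)"
    by (simp add: N.carrier_H1 cocycle_group_def)
  show ?thesis
  proof (rule homI)
    fix C assume "C \<in> carrier (H1 G N)"
    then obtain f where f: "f \<in> carrier (cocycle_group G N)" "C = H1_class G N f"
      by (auto simp: classes)
    then show "H1_map G N N' \<phi> C \<in> carrier (H1 G N')"
      using coc[of f] by (simp add: cl N'.carrier_H1 cocycle_group_def)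
    fix C' assume "C' \<in> carrier (H1 G N)"
    then obtain f' where f': "f' \<in> carrier (cocycle_group G N)" "C' = H1_class G N f'"
      by (auto simp: classes)
    have "C \<otimes>\<^bsub>H1 G N\<^esub> C' = H1_class G N (f \<otimes>\<^bsub>cocycle_group G N\<^esub> f')"
      using f f' by (simp add: H1_def H1_class_def Z.rcos_sum)
    moreover have "H1_class G N' (?\<phi> f) \<otimes>\<^bsub>H1 G N'\<^esub> H1_class G N' (?\<phi> f') =
        H1_class G N' (?\<phi> f \<otimes>\<^bsub>cocycle_group G N'\<^esub> ?\<phi> f')"
      using coc f f' by (simp add: H1_def H1_class_def Z'.rcos_sum)
    ultimately show "H1_map G N N' \<phi> (C \<otimes>\<^bsub>H1 G N\<^esub> C') =
        H1_map G N N' \<phi> C \<otimes>\<^bsub>H1 G N'\<^esub> H1_map G N N' \<phi> C'"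
      using f f' by (simp add: cl mult)
  qed
qed

lemma (in G_module) H1_class_eq_one_iff:
  assumes f: "f \<in> cocycles G N"
  shows "H1_class G N f = \<one>\<^bsub>H1 G N\<^esub> \<longleftrightarrow> f \<in> coboundaries G N"
proof -
  interpret Z: normal "coboundaries G N" "cocycle_group G N" by (rule coboundaries_normal)
  have "f \<in> carrier (cocycle_group G N)" using f by (simp add: cocycle_group_def)
  then show ?thesis
    using Z.rcos_self[of f] Z.rcos_const[of f] Z.subgroup_axioms
    by (auto simp: H1_def H1_class_def)
qed

lemma H1_map_mon:
  assumes N: "G_module G N" and N': "G_module G N'" and \<phi>: "\<phi> \<in> G_module_maps G N N'"
    and reflect: "\<And>f. \<lbrakk>f \<in> cocycles G N; (\<lambda>a\<in>carrier G. \<phi> (f a)) \<in> coboundaries G N'\<rbrakk>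
      \<Longrightarrow> f \<in> coboundaries G N"
  shows "H1_map G N N' \<phi> \<in> mon (H1 G N) (H1 G N')"
proof -
  interpret N: G_module G N by fact
  interpret N': G_module G N' by fact
  have "group (H1 G N)" "group (H1 G N')"
    using N.comm_group_H1 N'.comm_group_H1 by (simp_all add: comm_group_def)
  then show ?thesis
  proof (simp add: mon_iff_hom_one H1_map_hom[OF N N' \<phi>], intro allI impI, elim conjE)
    fix C assume "C \<in> carrier (H1 G N)" and one: "H1_map G N N' \<phi> C = \<one>\<^bsub>H1 G N'\<^esub>"
    then obtain f where f: "f \<in> cocycles G N" "C = H1_class G N f"
      by (auto simp: N.carrier_H1)
    have "(\<lambda>a\<in>carrier G. \<phi> (f a)) \<in> coboundaries G N'"
      using one f cocycles_map[OF N N' \<phi> f(1)]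
      by (simp add: H1_map_class[OF N N' \<phi>] N'.H1_class_eq_one_iff)
    then show "C = \<one>\<^bsub>H1 G N\<^esub>"
      using f reflect by (simp add: N.H1_class_eq_one_iff)
  qed
qed

text \<open>The coboundary condition is rewritten with \<open>act\<close> and addition only, the operations that an
  inclusion of modules preserves by definition.\<close>

lemma (in G_module) coboundaries_iff:
  assumes f: "f \<in> cocycles G N"
  shows "f \<in> coboundaries G N \<longleftrightarrow>
    (\<exists>\<alpha>\<in>carrier N. \<forall>b\<in>carrier G. act N b \<alpha> = f b \<oplus>\<^bsub>N\<^esub> \<alpha>)"
proof -
  have eq: "x = y \<ominus>\<^bsub>N\<^esub> z \<longleftrightarrow> y = x \<oplus>\<^bsub>N\<^esub> z"
    if "x \<in> carrier N" "y \<in> carrier N" "z \<in> carrier N" for x y z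
    using that by (auto simp: a_minus_def N.M.a_assoc N.M.l_neg N.M.r_neg)
  have "f = (\<lambda>b\<in>carrier G. act N b \<alpha> \<ominus>\<^bsub>N\<^esub> \<alpha>) \<longleftrightarrow>
      (\<forall>b\<in>carrier G. act N b \<alpha> = f b \<oplus>\<^bsub>N\<^esub> \<alpha>)" if \<alpha>: "\<alpha> \<in> carrier N" for \<alpha>
  proof -
    have "f = (\<lambda>b\<in>carrier G. act N b \<alpha> \<ominus>\<^bsub>N\<^esub> \<alpha>) \<longleftrightarrow>
        (\<forall>b\<in>carrier G. f b = act N b \<alpha> \<ominus>\<^bsub>N\<^esub> \<alpha>)"
      using cocycle_eqI[OF f, of "\<lambda>b\<in>carrier G. act N b \<alpha> \<ominus>\<^bsub>N\<^esub> \<alpha>"] by auto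
    then show ?thesis
      using \<alpha> f by (simp add: eq)
  qed
  then show ?thesis
    by (auto simp: coboundaries_def)
qed

section \<open>Injectivity on first cohomology\<close>

theorem theorem1:
  fixes G :: "('g, 'z) monoid_scheme"
    and M :: "('g \<Rightarrow> complex, 'g) gmodule"
    and nrm :: "('g \<Rightarrow> complex) \<Rightarrow> real"
    and p :: nat
  assumes "group G" and "infinite (carrier G)" and "finitely_generated G"
    and "complex_banach_module M nrm"
    and "G_module G M"
    and "\<And>g. g \<in> carrier G \<Longrightarrow> continuous_map (norm_topology M nrm) (norm_topology M nrm) (act M g)"
    and "p \<ge> 1"
    and "G_inclusion G (group_algebra G) M"
    and "G_inclusion G M (Lp G (real p))"
  shows "H1_map G (group_algebra G) M (\<lambda>x. x) \<in> mon (H1 G (group_algebra G)) (H1 G M)"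
proof -
  interpret G: group G by fact
  interpret M: G_module G M by fact
  interpret CG: G_module G "group_algebra G" by (rule G.G_module_group_algebra)
  let ?C = "carrier (group_algebra G)"
  have incl: "?C \<subseteq> carrier M" and map: "(\<lambda>x. x) \<in> G_module_maps G (group_algebra G) M"
    using \<open>G_inclusion G (group_algebra G) M\<close> by (auto simp: G_inclusion_def)
  have Lp: "x \<in> formal_sums G \<and> (\<lambda>g. cmod (x g) powr real p) summable_on carrier G"
    if "x \<in> carrier M" for x
    using \<open>G_inclusion G M (Lp G (real p))\<close> that
    by (auto simp: G_inclusion_def Lp_def formal_sum_module_def)
  have M_add: "x \<oplus>\<^bsub>M\<^esub> y = (\<lambda>g. x g + y g)" if "x \<in> carrier M" "y \<in> carrier M" for x y
    using \<open>G_inclusion G M (Lp G (real p))\<close> that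
    by (simp add: G_inclusion_def G_module_maps_def linear_maps_def Lp_def formal_sum_module_def)
  have M_act: "act M h x = left_mult G h x" if "h \<in> carrier G" "x \<in> carrier M" for h x
    using \<open>G_inclusion G M (Lp G (real p))\<close> that
    by (auto simp: G_inclusion_def G_module_maps_def Lp_def formal_sum_module_def)
  have C_iff: "x \<in> ?C \<longleftrightarrow> x \<in> formal_sums G \<and> finite {g. x g \<noteq> 0}" for x
    by (simp add: group_algebra_def formal_sum_module_def)
  show ?thesis
  proof (rule H1_map_mon[OF CG.G_module_axioms M.G_module_axioms map])
    fix f assume f: "f \<in> cocycles G (group_algebra G)"
      and cob: "(\<lambda>a\<in>carrier G. f a) \<in> coboundaries G M"
    obtain \<alpha> where \<alpha>: "\<alpha> \<in> carrier M"
      and eq: "\<And>h. h \<in> carrier G \<Longrightarrow> act M h \<alpha> = f h \<oplus>\<^bsub>M\<^esub> \<alpha>"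
      using cob cocycles_map[OF CG.G_module_axioms M.G_module_axioms map f]
      by (auto simp: M.coboundaries_iff)
    \<comment> \<open>Both operations of \<open>M\<close> are those of formal sums, so the identity becomes pointwise.\<close>
    have shift: "left_mult G h \<alpha> = (\<lambda>g. f h g + \<alpha> g)" if "h \<in> carrier G" for h
    proof -
      have "f h \<in> carrier M" using f that incl by auto
      then show ?thesis using eq[OF that] \<alpha> that by (simp add: M_act M_add)
    qed
    have "finite {x \<in> carrier G. \<alpha> (inv\<^bsub>G\<^esub> h \<otimes>\<^bsub>G\<^esub> x) \<noteq> \<alpha> x}" if h: "h \<in> carrier G" for h
    proof (rule finite_subset)
      show "finite {x. f h x \<noteq> 0}"
        using CG.cocycle_closed[OF f h] by (simp add: C_iff)
      show "{x \<in> carrier G. \<alpha> (inv\<^bsub>G\<^esub> h \<otimes>\<^bsub>G\<^esub> x) \<noteq> \<alpha> x} \<subseteq> {x. f h x \<noteq> 0}"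
      proof clarify
        fix x assume x: "x \<in> carrier G" "\<alpha> (inv\<^bsub>G\<^esub> h \<otimes>\<^bsub>G\<^esub> x) \<noteq> \<alpha> x" and "f h x = 0"
        with fun_cong[OF shift[OF h], of x] show False
          by (simp add: left_mult_def)
      qed
    qed
    then have "finite {x \<in> carrier G. \<alpha> x \<noteq> 0}"
      using Lp[OF \<alpha>] \<open>finitely_generated G\<close> by (blast intro: G.almost_invariant_finite_support)
    moreover have "{x \<in> carrier G. \<alpha> x \<noteq> 0} = {x. \<alpha> x \<noteq> 0}"
      using Lp[OF \<alpha>] by (auto simp: formal_sums_def)
    ultimately have \<alpha>C: "\<alpha> \<in> ?C"
      using Lp[OF \<alpha>] by (simp add: C_iff)
    have "act (group_algebra G) h \<alpha> = f h \<oplus>\<^bsub>group_algebra G\<^esub> \<alpha>" if "h \<in> carrier G" for h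
      using shift[OF that] \<alpha>C by (simp add: group_algebra_def formal_sum_module_def)
    with \<alpha>C show "f \<in> coboundaries G (group_algebra G)"
      by (auto simp: CG.coboundaries_iff[OF f])
  qed
qed

end
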